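(* Let $\mathcal H$ be a complex Hilbert space and let $T\in B(\mathcal H)$ be a bounded linear operator. Then the following conditions are equivalent: (i) there exists $m\in\mathbb N$ such that $T$ is an $m$-isometry; (ii) for every $h\in\mathcal H$, $\|T^nh\|^2$ is a polynomial in $n$; (iii) $\ker T=\{0\}$ and for every $h\in\mathcal H\setminus\{0\}$ there exists $m_h\in\mathbb N$ such that the unilateral weighted shift $W_{T,h}$ on $\ell^2$ with weights $\big\{\frac{\|T^{n+1}h\|}{\|T^nh\|}\big\}_{n=0}^\infty$ is an $m_h$-isometry; (iv) there exists a nonempty open subset $\mathscr V$ of $\mathcal H$ such that for every $h\in\mathscr V$ there exists $m_h\in\mathbb N$ with $\langle \mathscr B_{m_h}(T)h,h\rangle=0$; (v) for every $h\in\mathcal H$ there exists $m_h\in\mathbb N$ such that the restriction $T|_{\overline{\mathscr C_T(h)}}$ is an $m_h$-isometry. Moreover, if $m\geqslant 2$ is an integer and $T\in B(\mathcal H)$ is a strict $m$-isometry, then (a) $\mathcal H=\{h\in\mathcal H:\ \|T^nh\|^2 \text{ is a polynomial in } n \text{ of degree at most } m-1\}$; (b) the set $\{h\in\mathcal H:\ \|T^nh\|^2 \text{ is a polynomial in } n \text{ of degree at most } m-2\}$ is a closed nowhere dense subset of $\mathcal H$; (c) the set $\{h\in\mathcal H:\ \|T^nh\|^2 \text{ is a polynomial in } n \text{ of degree } m-1\}$ is an open dense subset of $\mathcal H$.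
   Context: $\mathbb N$ denotes the positive integers and $\mathbb Z_+$ the nonnegative integers. $B(\mathcal H)$ is the algebra of all bounded linear operators on $\mathcal H$. For $T\in B(\mathcal H)$ and $m\in\mathbb Z_+$ put $\mathscr B_m(T)=\sum_{k=0}^m(-1)^k\binom mk T^{*k}T^k$. For $m\in\mathbb N$, $T$ is an $m$-isometry if $\mathscr B_m(T)=0$ (equivalently $\sum_{k=0}^m(-1)^k\binom mk\|T^kh\|^2=0$ for all $h\in\mathcal H$). An $m$-isometry $T$ is strict if either $m=1$ and $\mathcal H\ne\{0\}$, or $m\geqslant2$ and $T$ is not an $(m-1)$-isometry. A complex sequence $\{\gamma_n\}_{n=0}^\infty$ is said to be a polynomial in $n$ (of degree $k$) if there is a polynomial $p\in\mathbb C[x]$ (of degree $k$) such that $\gamma_n=p(n)$ for all $n\in\mathbb Z_+$; the zero polynomial has degree $-\infty$. $\mathscr C_T(h)$ is the linear span of $\{T^nh: n\in\mathbb Z_+\}$. $\ell^2$ is the Hilbert space of square summable complex sequences indexed by $\mathbb Z_+$ with standard orthonormal basis $\{e_n\}_{n=0}^\infty$; the unilateral weighted shift with (bounded) weights $\{\lambda_n\}_{n=0}^\infty\subseteq\mathbb C$ is the unique $W\in B(\ell^2)$ with $We_n=\lambda_ne_{n+1}$ for all $n\in\mathbb Z_+$. (The weights in (iii) are bounded by $\|T\|$.) *)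

theory Defs
  imports "HOL-Analysis.Analysis" "HOL-Computational_Algebra.Polynomial"
begin

section \<open>Complex Hilbert spaces\<close>

class complex_vector = real_vector +
  fixes scaleC :: "complex \<Rightarrow> 'a \<Rightarrow> 'a" (infixr \<open>*\<^sub>C\<close> 75)
  assumes scaleC_add_right: "a *\<^sub>C (x + y) = a *\<^sub>C x + a *\<^sub>C y"
    and scaleC_add_left: "(a + b) *\<^sub>C x = a *\<^sub>C x + b *\<^sub>C x"
    and scaleC_scaleC: "a *\<^sub>C b *\<^sub>C x = (a * b) *\<^sub>C x"
    and scaleC_one: "1 *\<^sub>C x = x"
    and scaleR_scaleC: "r *\<^sub>R x = complex_of_real r *\<^sub>C x"

text \<open>
  The norm and the topology are those of \<^class>\<open>real_inner\<close>: the real inner product is the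
  real part of the complex one, so that \<open>norm x = sqrt (Re (cinner x x))\<close>, where \<open>cinner x x\<close>
  is real by conjugate symmetry.
\<close>

class complex_inner = complex_vector + real_inner +
  fixes cinner :: "'a \<Rightarrow> 'a \<Rightarrow> complex"
  assumes cinner_commute: "cinner x y = cnj (cinner y x)"
    and cinner_add_left: "cinner (x + y) z = cinner x z + cinner y z"
    and cinner_scaleC_left: "cinner (a *\<^sub>C x) y = a * cinner x y"
    and inner_Re_cinner: "inner x y = Re (cinner x y)"

class chilbert_space = complex_inner + banach

global_interpretation complex_vector: vector_space "scaleC :: complex \<Rightarrow> 'a \<Rightarrow> 'a::complex_vector"
  defines cspan = "complex_vector.span"
    and csubspace = "complex_vector.subspace"
  by unfold_locales
    (simp_all add: scaleC_add_right scaleC_add_left scaleC_scaleC scaleC_one)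

definition bounded_clinear :: "('a::complex_inner \<Rightarrow> 'b::complex_inner) \<Rightarrow> bool" where
  "bounded_clinear T \<longleftrightarrow> bounded_linear T \<and> (\<forall>c x. T (c *\<^sub>C x) = c *\<^sub>C T x)"


section \<open>Operators on closed invariant subspaces and \<open>m\<close>-isometries\<close>

text \<open>
  The Hilbert space on which an operator acts is a closed subspace \<open>M\<close> of the type (\<open>UNIV\<close> for
  the type itself), and the operator is the restriction of \<open>T\<close> to \<open>M\<close>, where \<open>T\<close> maps \<open>M\<close> into
  itself. In particular \<open>cadjoint_on M T\<close> is the adjoint of the restriction as an operator on
  \<open>M\<close>; it is not the restriction to \<open>M\<close> of the adjoint of \<open>T\<close>. The
  description is proper for every bounded \<open>T\<close> by the Riesz representation theorem on \<open>M\<close>.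
\<close>

definition cadjoint_on ::
    "'a::complex_inner set \<Rightarrow> ('a \<Rightarrow> 'a) \<Rightarrow> 'a \<Rightarrow> 'a" where
  "cadjoint_on M T y = (THE z. z \<in> M \<and> (\<forall>x\<in>M. cinner (T x) y = cinner x z))"

lemma cadjoint_on_eqI:
  fixes T :: "'a::complex_inner \<Rightarrow> 'a"
  assumes M: "csubspace M" and z: "z \<in> M" "\<And>x. x \<in> M \<Longrightarrow> cinner (T x) y = cinner x z"
  shows "cadjoint_on M T y = z"
  unfolding cadjoint_on_def
proof (rule the_equality)
  show "z \<in> M \<and> (\<forall>x\<in>M. cinner (T x) y = cinner x z)"
    using z by blast
next
  fix w assume w: "w \<in> M \<and> (\<forall>x\<in>M. cinner (T x) y = cinner x w)"
  have d: "w - z \<in> M"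
    using M w z(1) complex_vector.subspace_diff by blast
  then have "inner (w - z) w = inner (w - z) z"
    using w z(2) by (metis inner_Re_cinner)
  then have "inner (w - z) (w - z) = 0"
    by (simp add: inner_diff_right)
  then show "w = z"
    by simp
qed

definition defect_on ::
    "'a::complex_inner set \<Rightarrow> nat \<Rightarrow> ('a \<Rightarrow> 'a) \<Rightarrow> 'a \<Rightarrow> 'a" where
  "defect_on M m T h =
     (\<Sum>k\<le>m. ((-1) ^ k * of_nat (m choose k)) *\<^sub>C (cadjoint_on M T ^^ k) ((T ^^ k) h))"

definition m_isometry_on :: "'a::complex_inner set \<Rightarrow> nat \<Rightarrow> ('a \<Rightarrow> 'a) \<Rightarrow> bool" where
  "m_isometry_on M m T \<longleftrightarrow> m \<ge> 1 \<and> (\<forall>h\<in>M. defect_on M m T h = 0)"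

abbreviation m_isometry :: "nat \<Rightarrow> ('a::complex_inner \<Rightarrow> 'a) \<Rightarrow> bool" where
  "m_isometry \<equiv> m_isometry_on UNIV"

definition strict_m_isometry :: "nat \<Rightarrow> ('a::complex_inner \<Rightarrow> 'a) \<Rightarrow> bool" where
  "strict_m_isometry m T \<longleftrightarrow> m_isometry m T \<and>
     (m = 1 \<and> (UNIV :: 'a set) \<noteq> {0} \<or> m \<ge> 2 \<and> \<not> m_isometry (m - 1) T)"

definition orbit_span :: "('a::complex_inner \<Rightarrow> 'a) \<Rightarrow> 'a \<Rightarrow> 'a set" where
  "orbit_span T h = cspan (range (\<lambda>n. (T ^^ n) h))"

lemma orbit_span_invariant:
  assumes T: "bounded_clinear T"
  shows "T ` closure (orbit_span T h) \<subseteq> closure (orbit_span T h)"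
proof -
  have bl: "bounded_linear T" and lin: "T (c *\<^sub>C x) = c *\<^sub>C T x" for c x
    using T by (simp_all add: bounded_clinear_def)
  note lin = lin linear_add[OF bounded_linear.linear[OF bl]] linear_0[OF bounded_linear.linear[OF bl]]
  have *: "T x \<in> orbit_span T h" if "x \<in> orbit_span T h" for x
    using that unfolding orbit_span_def
  proof (induction rule: complex_vector.span_induct_alt)
    case base
    then show ?case by (simp add: lin complex_vector.span_zero)
  next
    case (step c x y)
    then obtain n where "x = (T ^^ n) h" by auto
    then have "T x = (T ^^ Suc n) h" by simp
    then have "T x \<in> range (\<lambda>n. (T ^^ n) h)" by (rule range_eqI)
    then have "T x \<in> cspan (range (\<lambda>n. (T ^^ n) h))"
      by (rule complex_vector.span_base)
    then show ?case
      unfolding lin using step(2)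
      by (intro complex_vector.span_add complex_vector.span_scale)
  qed
  have "continuous_on (closure (orbit_span T h)) T"
    using bl by (rule linear_continuous_on)
  then show ?thesis
  proof (rule image_closure_subset)
    show "T ` orbit_span T h \<subseteq> closure (orbit_span T h)"
      using * closure_subset by blast
  qed simp
qed


section \<open>Sequences that are polynomials in \<open>n\<close>\<close>

definition poly_seq :: "(nat \<Rightarrow> complex) \<Rightarrow> bool" where
  "poly_seq \<gamma> \<longleftrightarrow> (\<exists>p :: complex poly. \<forall>n. \<gamma> n = poly p (of_nat n))"

text \<open>
  The degree of the zero polynomial is minus infinity, whereas \<open>degree 0 = 0\<close> in the library.
\<close>

definition poly_seq_degree :: "nat \<Rightarrow> (nat \<Rightarrow> complex) \<Rightarrow> bool" where
  "poly_seq_degree k \<gamma> \<longleftrightarrow>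
     (\<exists>p :: complex poly. p \<noteq> 0 \<and> degree p = k \<and> (\<forall>n. \<gamma> n = poly p (of_nat n)))"

definition poly_seq_degree_le :: "nat \<Rightarrow> (nat \<Rightarrow> complex) \<Rightarrow> bool" where
  "poly_seq_degree_le k \<gamma> \<longleftrightarrow>
     (\<exists>p :: complex poly. degree p \<le> k \<and> (\<forall>n. \<gamma> n = poly p (of_nat n)))"

definition orbit_norm_sq :: "('a::real_normed_vector \<Rightarrow> 'a) \<Rightarrow> 'a \<Rightarrow> nat \<Rightarrow> complex" where
  "orbit_norm_sq T h n = complex_of_real ((norm ((T ^^ n) h))\<^sup>2)"


section \<open>The space \<open>\<ell>\<^sup>2\<close> and unilateral weighted shifts\<close>

typedef ell2 = "{f :: nat \<Rightarrow> complex. summable (\<lambda>n. (cmod (f n))\<^sup>2)}"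
  morphisms ell2_nth Abs_ell2
  by (rule exI[of _ "\<lambda>_. 0"]) simp

setup_lifting type_definition_ell2

lemma ell2_summable: "summable (\<lambda>n. (cmod (ell2_nth f n))\<^sup>2)"
  using ell2_nth by auto

lemma ell2_eqI: "(\<And>n. ell2_nth f n = ell2_nth g n) \<Longrightarrow> f = g"
  by (metis ell2_nth_inject ext)

lemma square_summable_add:
  assumes "summable (\<lambda>n. (cmod (f n))\<^sup>2)" "summable (\<lambda>n. (cmod (g n))\<^sup>2)"
  shows "summable (\<lambda>n. (cmod (f n + g n))\<^sup>2)"
proof (rule summable_comparison_test')
  show "summable (\<lambda>n. 2 * (cmod (f n))\<^sup>2 + 2 * (cmod (g n))\<^sup>2)"
    using assms by (intro summable_add summable_mult)
  fix n
  have "(cmod (f n + g n))\<^sup>2 \<le> (cmod (f n) + cmod (g n))\<^sup>2"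
    by (intro power_mono norm_triangle_ineq) simp
  also have "\<dots> \<le> 2 * (cmod (f n))\<^sup>2 + 2 * (cmod (g n))\<^sup>2"
    using sum_squares_bound[of "cmod (f n)" "cmod (g n)"] by (simp add: power2_sum)
  finally show "norm ((cmod (f n + g n))\<^sup>2) \<le> 2 * (cmod (f n))\<^sup>2 + 2 * (cmod (g n))\<^sup>2"
    by simp
qed

lemma square_summable_mult:
  assumes "summable (\<lambda>n. (cmod (f n))\<^sup>2)" "summable (\<lambda>n. (cmod (g n))\<^sup>2)"
  shows "summable (\<lambda>n. f n * cnj (g n))"
proof (rule summable_comparison_test')
  show "summable (\<lambda>n. (cmod (f n))\<^sup>2 + (cmod (g n))\<^sup>2)"
    using assms by (intro summable_add)
  fix n
  have "2 * (cmod (f n) * cmod (g n)) \<le> (cmod (f n))\<^sup>2 + (cmod (g n))\<^sup>2"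
    using sum_squares_bound[of "cmod (f n)" "cmod (g n)"] by simp
  moreover have "0 \<le> cmod (f n) * cmod (g n)"
    by simp
  ultimately show "norm (f n * cnj (g n)) \<le> (cmod (f n))\<^sup>2 + (cmod (g n))\<^sup>2"
    unfolding norm_mult complex_mod_cnj by linarith
qed

instantiation ell2 :: complex_inner
begin

lift_definition zero_ell2 :: ell2 is "\<lambda>_. 0" by simp

lift_definition plus_ell2 :: "ell2 \<Rightarrow> ell2 \<Rightarrow> ell2" is "\<lambda>f g n. f n + g n"
  by (rule square_summable_add)

lift_definition uminus_ell2 :: "ell2 \<Rightarrow> ell2" is "\<lambda>f n. - f n" by simp

lift_definition minus_ell2 :: "ell2 \<Rightarrow> ell2 \<Rightarrow> ell2" is "\<lambda>f g n. f n - g n"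
  subgoal for f g using square_summable_add[of f "\<lambda>n. - g n"] by simp
  done

lift_definition scaleC_ell2 :: "complex \<Rightarrow> ell2 \<Rightarrow> ell2" is "\<lambda>c f n. c * f n"
  by (simp add: norm_mult power_mult_distrib summable_mult)

lift_definition scaleR_ell2 :: "real \<Rightarrow> ell2 \<Rightarrow> ell2" is "\<lambda>r f n. complex_of_real r * f n"
  by (simp add: norm_mult power_mult_distrib summable_mult)

definition cinner_ell2 :: "ell2 \<Rightarrow> ell2 \<Rightarrow> complex" where
  "cinner_ell2 f g = (\<Sum>n. ell2_nth f n * cnj (ell2_nth g n))"

definition inner_ell2 :: "ell2 \<Rightarrow> ell2 \<Rightarrow> real" where
  "inner_ell2 f g = Re (cinner f g)"

definition norm_ell2 :: "ell2 \<Rightarrow> real" where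
  "norm_ell2 f = sqrt (inner f f)"

definition sgn_ell2 :: "ell2 \<Rightarrow> ell2" where
  "sgn_ell2 f = inverse (norm f) *\<^sub>R f"

definition dist_ell2 :: "ell2 \<Rightarrow> ell2 \<Rightarrow> real" where
  "dist_ell2 f g = norm (f - g)"

definition uniformity_ell2 :: "(ell2 \<times> ell2) filter" where
  "uniformity_ell2 = (INF e\<in>{0<..}. principal {(x, y). dist x y < e})"

definition open_ell2 :: "ell2 set \<Rightarrow> bool" where
  "open_ell2 U \<longleftrightarrow> (\<forall>x\<in>U. eventually (\<lambda>(x', y). x' = x \<longrightarrow> y \<in> U) uniformity)"

lemma cinner_ell2_summable: "summable (\<lambda>n. ell2_nth f n * cnj (ell2_nth g n))"
  by (intro square_summable_mult ell2_summable)

lemma cinner_ell2_self: "cinner f f = complex_of_real (\<Sum>n. (cmod (ell2_nth f n))\<^sup>2)"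
proof -
  have "(\<lambda>n. complex_of_real ((cmod (ell2_nth f n))\<^sup>2)) sums
      complex_of_real (\<Sum>n. (cmod (ell2_nth f n))\<^sup>2)"
    using summable_sums[OF ell2_summable] by (rule sums_of_real)
  then show ?thesis
    unfolding cinner_ell2_def
    by (simp only: complex_norm_square[symmetric] sums_iff)
qed

instance
proof
  fix f g h :: ell2 and a b :: complex and r s :: real
  show "f + g + h = f + (g + h)" by transfer (simp add: add.assoc)
  show "f + g = g + f" by transfer (simp add: add.commute)
  show "0 + f = f" by transfer simp
  show "- f + f = 0" by transfer simp
  show "f - g = f + - g" by transfer simp
  show "r *\<^sub>R (f + g) = r *\<^sub>R f + r *\<^sub>R g" by transfer (simp add: distrib_left)
  show "(r + s) *\<^sub>R f = r *\<^sub>R f + s *\<^sub>R f" by transfer (simp add: distrib_right)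
  show "r *\<^sub>R s *\<^sub>R f = (r * s) *\<^sub>R f" by transfer (simp add: mult.assoc)
  show "1 *\<^sub>R f = f" by transfer simp
  show "a *\<^sub>C (f + g) = a *\<^sub>C f + a *\<^sub>C g" by transfer (simp add: distrib_left)
  show "(a + b) *\<^sub>C f = a *\<^sub>C f + b *\<^sub>C f" by transfer (simp add: distrib_right)
  show "a *\<^sub>C b *\<^sub>C f = (a * b) *\<^sub>C f" by transfer (simp add: mult.assoc)
  show "1 *\<^sub>C f = f" by transfer simp
  show "r *\<^sub>R f = complex_of_real r *\<^sub>C f" by transfer simp
  show "sgn f = inverse (norm f) *\<^sub>R f" by (simp add: sgn_ell2_def)
  show "dist f g = norm (f - g)" by (simp add: dist_ell2_def)
  show "uniformity = (INF e\<in>{0<..}. principal {(x, y :: ell2). dist x y < e})"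
    by (simp add: uniformity_ell2_def)
  show "open U \<longleftrightarrow> (\<forall>x\<in>U. \<forall>\<^sub>F (x', y) in uniformity. x' = x \<longrightarrow> y \<in> U)" for U :: "ell2 set"
    by (simp add: open_ell2_def)
  show c: "cinner f g = cnj (cinner g f)" for f g :: ell2
    using sums_cnj[THEN iffD2, OF summable_sums[OF cinner_ell2_summable[of g f]]]
    by (simp add: cinner_ell2_def sums_iff mult.commute)
  show add: "cinner (f + g) h = cinner f h + cinner g h"
    unfolding cinner_ell2_def
    by (subst suminf_add[OF cinner_ell2_summable cinner_ell2_summable])
      (simp add: plus_ell2.rep_eq distrib_right)
  show scale: "cinner (a *\<^sub>C f) g = a * cinner f g" for a and f g :: ell2
    unfolding cinner_ell2_def
    by (subst suminf_mult[OF cinner_ell2_summable, symmetric])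
      (simp add: scaleC_ell2.rep_eq mult.assoc)
  show "inner f g = Re (cinner f g)" by (simp add: inner_ell2_def)
  show "inner f g = inner g f" by (simp add: inner_ell2_def c[of f g])
  show "inner (f + g) h = inner f h + inner g h" by (simp add: inner_ell2_def add)
  have "r *\<^sub>R f = complex_of_real r *\<^sub>C f" by transfer simp
  then show "inner (r *\<^sub>R f) g = r * inner f g" by (simp add: inner_ell2_def scale)
  show "0 \<le> inner f f"
    by (simp add: inner_ell2_def cinner_ell2_self suminf_nonneg[OF ell2_summable])
  show "inner f f = 0 \<longleftrightarrow> f = 0"
    by (simp add: inner_ell2_def cinner_ell2_self suminf_eq_zero_iff[OF ell2_summable])
      (metis ell2_eqI zero_ell2.rep_eq)
  show "norm f = sqrt (inner f f)" by (simp add: norm_ell2_def)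
qed

end

lemma norm_ell2_sq: "(norm (f :: ell2))\<^sup>2 = (\<Sum>n. (cmod (ell2_nth f n))\<^sup>2)"
  by (simp add: norm_ell2_def inner_ell2_def cinner_ell2_self suminf_nonneg[OF ell2_summable])

lemma ell2_partial_sum_le: "(\<Sum>n<N. (cmod (ell2_nth f n))\<^sup>2) \<le> (norm f)\<^sup>2"
  unfolding norm_ell2_sq by (intro sum_le_suminf ell2_summable) auto

lemma cmod_ell2_nth_le: "cmod (ell2_nth f n) \<le> norm f"
proof -
  have "(cmod (ell2_nth f n))\<^sup>2 \<le> (\<Sum>k<Suc n. (cmod (ell2_nth f k))\<^sup>2)"
    by (simp add: sum_nonneg)
  also have "\<dots> \<le> (norm f)\<^sup>2" by (rule ell2_partial_sum_le)
  finally show ?thesis by (rule power2_le_imp_le) simp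
qed

instance ell2 :: chilbert_space
proof
  fix X :: "nat \<Rightarrow> ell2"
  assume X: "Cauchy X"
  have "Cauchy (\<lambda>m. ell2_nth (X m) n)" for n
  proof (rule metric_CauchyI)
    fix e :: real assume "0 < e"
    then obtain M where M: "\<And>i j. i \<ge> M \<Longrightarrow> j \<ge> M \<Longrightarrow> dist (X i) (X j) < e"
      using X unfolding Cauchy_def by blast
    have "dist (ell2_nth (X i) n) (ell2_nth (X j) n) < e" if "i \<ge> M" "j \<ge> M" for i j
      using cmod_ell2_nth_le[of "X i - X j" n] M[OF that]
      by (simp add: dist_norm minus_ell2.rep_eq)
    then show "\<exists>M. \<forall>i\<ge>M. \<forall>j\<ge>M. dist (ell2_nth (X i) n) (ell2_nth (X j) n) < e"
      by blast
  qed
  then have "\<exists>l. (\<lambda>m. ell2_nth (X m) n) \<longlonglongrightarrow> l" for n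
    using Cauchy_convergent convergent_def by blast
  then obtain a where a: "\<And>n. (\<lambda>m. ell2_nth (X m) n) \<longlonglongrightarrow> a n"
    by metis
  have tail: "\<exists>M. \<forall>i\<ge>M. summable (\<lambda>n. (cmod (ell2_nth (X i) n - a n))\<^sup>2) \<and>
      (\<Sum>n. (cmod (ell2_nth (X i) n - a n))\<^sup>2) \<le> e\<^sup>2" if "0 < e" for e
  proof -
    obtain M where M: "\<And>i j. i \<ge> M \<Longrightarrow> j \<ge> M \<Longrightarrow> dist (X i) (X j) < e"
      using X \<open>0 < e\<close> unfolding Cauchy_def by blast
    have bound: "(\<Sum>n<N. (cmod (ell2_nth (X i) n - a n))\<^sup>2) \<le> e\<^sup>2" if "i \<ge> M" for i N
    proof (rule LIMSEQ_le_const2)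
      show "(\<lambda>j. \<Sum>n<N. (cmod (ell2_nth (X i) n - ell2_nth (X j) n))\<^sup>2)
          \<longlonglongrightarrow> (\<Sum>n<N. (cmod (ell2_nth (X i) n - a n))\<^sup>2)"
        by (intro tendsto_intros a)
      have "(\<Sum>n<N. (cmod (ell2_nth (X i) n - ell2_nth (X j) n))\<^sup>2) \<le> e\<^sup>2" if "j \<ge> M" for j
      proof -
        have "(\<Sum>n<N. (cmod (ell2_nth (X i) n - ell2_nth (X j) n))\<^sup>2) \<le> (norm (X i - X j))\<^sup>2"
          using ell2_partial_sum_le[where f = "X i - X j"] by (simp add: minus_ell2.rep_eq)
        also have "\<dots> \<le> e\<^sup>2"
          using M[OF \<open>i \<ge> M\<close> that] by (intro power_mono) (auto simp: dist_norm)
        finally show ?thesis .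
      qed
      then show "\<exists>N'. \<forall>j\<ge>N'. (\<Sum>n<N. (cmod (ell2_nth (X i) n - ell2_nth (X j) n))\<^sup>2) \<le> e\<^sup>2"
        by blast
    qed
    show ?thesis
    proof (intro exI[of _ M] allI impI conjI)
      fix i assume i: "i \<ge> M"
      show s: "summable (\<lambda>n. (cmod (ell2_nth (X i) n - a n))\<^sup>2)"
        by (rule summableI_nonneg_bounded[where x = "e\<^sup>2"]) (use bound[OF i] in auto)
      show "(\<Sum>n. (cmod (ell2_nth (X i) n - a n))\<^sup>2) \<le> e\<^sup>2"
        by (rule suminf_le_const[OF s]) (rule bound[OF i])
    qed
  qed
  obtain i where "summable (\<lambda>n. (cmod (ell2_nth (X i) n - a n))\<^sup>2)"
    using tail[of 1] by auto
  then have "summable (\<lambda>n. (cmod (a n - ell2_nth (X i) n))\<^sup>2)"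
    by (simp add: norm_minus_commute)
  from square_summable_add[OF this ell2_summable[of "X i"]]
  have "summable (\<lambda>n. (cmod (a n))\<^sup>2)"
    by simp
  then have nth: "ell2_nth (Abs_ell2 a) = a"
    by (simp add: Abs_ell2_inverse)
  have "X \<longlonglongrightarrow> Abs_ell2 a"
  proof (rule metric_LIMSEQ_I)
    fix r :: real assume "0 < r"
    then obtain M where M: "\<And>i. i \<ge> M \<Longrightarrow> (\<Sum>n. (cmod (ell2_nth (X i) n - a n))\<^sup>2) \<le> (r / 2)\<^sup>2"
      using tail[of "r / 2"] by auto
    have "dist (X i) (Abs_ell2 a) < r" if "i \<ge> M" for i
    proof -
      have "(norm (X i - Abs_ell2 a))\<^sup>2 \<le> (r / 2)\<^sup>2"
        using M[OF that] by (simp add: norm_ell2_sq minus_ell2.rep_eq nth)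
      then have "norm (X i - Abs_ell2 a) \<le> r / 2"
        by (rule power2_le_imp_le) (use \<open>0 < r\<close> in simp)
      then show ?thesis
        using \<open>0 < r\<close> by (simp add: dist_norm)
    qed
    then show "\<exists>M. \<forall>i\<ge>M. dist (X i) (Abs_ell2 a) < r"
      by blast
  qed
  then show "convergent X"
    by (auto simp: convergent_def)
qed

lift_definition ell2_basis :: "nat \<Rightarrow> ell2" is "\<lambda>k n. if n = k then 1 else 0"
  subgoal for k by (rule summable_finite[of "{k}"]) auto
  done

definition weighted_shift :: "(nat \<Rightarrow> complex) \<Rightarrow> ell2 \<Rightarrow> ell2" where
  "weighted_shift ws =
     (THE W. bounded_clinear W \<and> (\<forall>n. W (ell2_basis n) = ws n *\<^sub>C ell2_basis (Suc n)))"

lemma ell2_basis_expansion: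
  "(\<lambda>N. \<Sum>k<N. ell2_nth f k *\<^sub>C ell2_basis k) \<longlonglongrightarrow> f"
proof -
  have nth: "ell2_nth (\<Sum>k<N. ell2_nth f k *\<^sub>C ell2_basis k) n =
      (if n < N then ell2_nth f n else 0)" for N n
    by (induction N)
      (auto simp: zero_ell2.rep_eq plus_ell2.rep_eq scaleC_ell2.rep_eq ell2_basis.rep_eq less_Suc_eq)
  let ?d = "\<lambda>N. f - (\<Sum>k<N. ell2_nth f k *\<^sub>C ell2_basis k)"
  have dn: "ell2_nth (?d N) n = (if n < N then 0 else ell2_nth f n)" for N n
    by (simp add: minus_ell2.rep_eq nth)
  have "(norm (?d N))\<^sup>2 = (\<Sum>n. (cmod (ell2_nth f (n + N)))\<^sup>2)" for N
  proof -
    have "(norm (?d N))\<^sup>2 = (\<Sum>n. (cmod (ell2_nth (?d N) (n + N)))\<^sup>2) +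
        (\<Sum>n<N. (cmod (ell2_nth (?d N) n))\<^sup>2)"
      unfolding norm_ell2_sq by (rule suminf_split_initial_segment[OF ell2_summable])
    then show ?thesis by (simp add: dn)
  qed
  moreover have "(\<lambda>N. \<Sum>n. (cmod (ell2_nth f (n + N)))\<^sup>2) \<longlonglongrightarrow> 0"
    by (rule suminf_exist_split2[OF ell2_summable])
  ultimately have "(\<lambda>N. (norm (?d N))\<^sup>2) \<longlonglongrightarrow> 0"
    by simp
  from tendsto_real_sqrt[OF this] have "?d \<longlonglongrightarrow> 0"
    by (simp add: tendsto_norm_zero_iff)
  from tendsto_diff[OF tendsto_const[of f] this] show ?thesis
    by simp
qed

lemma weighted_shift_unique:
  fixes V W :: "ell2 \<Rightarrow> ell2"
  assumes "bounded_clinear V" "bounded_clinear W"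
    and eq: "\<And>n. V (ell2_basis n) = W (ell2_basis n)"
  shows "V = W"
proof
  fix f :: ell2
  let ?s = "\<lambda>N. \<Sum>k<N. ell2_nth f k *\<^sub>C ell2_basis k"
  have lin: "(\<lambda>N. U (?s N)) \<longlonglongrightarrow> U f"
    if "bounded_clinear U" for U :: "ell2 \<Rightarrow> ell2"
    using that bounded_linear.tendsto[OF _ ell2_basis_expansion]
    unfolding bounded_clinear_def by blast
  have sum: "U (?s N) = (\<Sum>k<N. ell2_nth f k *\<^sub>C U (ell2_basis k))"
    if U: "bounded_clinear U" for U :: "ell2 \<Rightarrow> ell2" and N
  proof -
    have "linear U" and "\<And>c x. U (c *\<^sub>C x) = c *\<^sub>C U x"
      using U by (auto simp: bounded_clinear_def intro: bounded_linear.linear)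
    then show ?thesis
      by (simp add: linear_sum)
  qed
  have "(\<lambda>N. V (?s N)) = (\<lambda>N. W (?s N))"
    by (simp add: sum[OF assms(1)] sum[OF assms(2)] eq)
  then show "V f = W f"
    using lin[OF assms(1)] lin[OF assms(2)] LIMSEQ_unique by metis
qed

lemma weighted_shift:
  assumes bdd: "\<And>n. cmod (ws n) \<le> B"
  shows "bounded_clinear (weighted_shift ws)"
    and "weighted_shift ws (ell2_basis n) = ws n *\<^sub>C ell2_basis (Suc n)"
    and "ell2_nth (weighted_shift ws f) n =
           (case n of 0 \<Rightarrow> 0 | Suc k \<Rightarrow> ws k * ell2_nth f k)"
proof -
  let ?v = "\<lambda>f n. case n of 0 \<Rightarrow> 0 | Suc k \<Rightarrow> ws k * ell2_nth f k"
  define W where "W f = Abs_ell2 (?v f)" for f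
  have le: "(cmod (ws k * ell2_nth f k))\<^sup>2 \<le> B\<^sup>2 * (cmod (ell2_nth f k))\<^sup>2" for f k
    using power_mono[OF bdd[of k], of 2] by (simp add: norm_mult power_mult_distrib mult_right_mono)
  have sum_k: "summable (\<lambda>k. (cmod (ws k * ell2_nth f k))\<^sup>2)" for f
  proof (rule summable_comparison_test')
    show "summable (\<lambda>k. B\<^sup>2 * (cmod (ell2_nth f k))\<^sup>2)"
      by (intro summable_mult ell2_summable)
    show "norm ((cmod (ws k * ell2_nth f k))\<^sup>2) \<le> B\<^sup>2 * (cmod (ell2_nth f k))\<^sup>2" for k
      using le[of k f] by simp
  qed
  have summ: "summable (\<lambda>n. (cmod (?v f n))\<^sup>2)" for f
    by (subst summable_Suc_iff[symmetric]) (simp add: sum_k)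
  have nth: "ell2_nth (W f) = ?v f" for f
    unfolding W_def by (rule Abs_ell2_inverse) (use summ[of f] in simp)
  have W: "bounded_clinear W"
    unfolding bounded_clinear_def
  proof (intro conjI allI)
    show "W (c *\<^sub>C f) = c *\<^sub>C W f" for c f
      by (rule ell2_eqI) (simp add: nth scaleC_ell2.rep_eq split: nat.split)
    show "bounded_linear W"
    proof (rule bounded_linear_intro[where K = B])
      show "W (f + g) = W f + W g" for f g
        by (rule ell2_eqI) (simp add: nth plus_ell2.rep_eq distrib_left split: nat.split)
      show "W (r *\<^sub>R f) = r *\<^sub>R W f" for r f
        by (rule ell2_eqI) (simp add: nth scaleR_ell2.rep_eq split: nat.split)
      fix f
      have "0 \<le> B" using bdd[of 0] norm_ge_zero order_trans by blast
      have "(norm (W f))\<^sup>2 = (\<Sum>k. (cmod (ws k * ell2_nth f k))\<^sup>2)"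
        unfolding norm_ell2_sq nth
        using suminf_split_initial_segment[OF summ[of f], of 1] by simp
      also have "\<dots> \<le> (\<Sum>k. B\<^sup>2 * (cmod (ell2_nth f k))\<^sup>2)"
        by (intro suminf_le le sum_k summable_mult ell2_summable)
      also have "\<dots> = (norm f * B)\<^sup>2"
        by (simp add: suminf_mult[OF ell2_summable] norm_ell2_sq power_mult_distrib)
      finally show "norm (W f) \<le> norm f * B"
        by (rule power2_le_imp_le) (use \<open>0 \<le> B\<close> in simp)
    qed
  qed
  have basis: "W (ell2_basis n) = ws n *\<^sub>C ell2_basis (Suc n)" for n
    by (rule ell2_eqI) (simp add: nth scaleC_ell2.rep_eq ell2_basis.rep_eq split: nat.split)
  have "weighted_shift ws = W"
    unfolding weighted_shift_def
  proof (rule the_equality)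
    show "bounded_clinear W \<and> (\<forall>n. W (ell2_basis n) = ws n *\<^sub>C ell2_basis (Suc n))"
      using W basis by blast
  qed (rule weighted_shift_unique, use W basis in auto)
  then show "bounded_clinear (weighted_shift ws)"
    and "weighted_shift ws (ell2_basis n) = ws n *\<^sub>C ell2_basis (Suc n)"
    and "ell2_nth (weighted_shift ws f) n =
           (case n of 0 \<Rightarrow> 0 | Suc k \<Rightarrow> ws k * ell2_nth f k)"
    using W basis nth by auto
qed

end

(* The quadratic form of the m-th defect operator at h is the alternating sum
     b_m(h) = \<Sum>k\<le>m. (-1)^k (m choose k) (norm (T^k h))^2,
   so T is an m-isometry iff b_m vanishes identically (polarization). Since b_m(T^n h) is, up to
   sign, the m-th difference of the sequence (norm (T^n h))^2, it vanishes for all n iff that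
   sequence is a polynomial in n of degree less than m. For the shift W attached to h, b_m for W is
   a weighted sum of the numbers b_m(T^n h). Conversely, if the order m depends on h, Baire's theorem
   applied to the closed sets {b_m = 0} yields an m for which b_m vanishes on a ball, and a quadratic
   form vanishing on a ball is zero. The same fact makes {b_(m-1) = 0} nowhere dense for a strict
   m-isometry. *)

theory Submission
  imports Defs
begin

section \<open>Alternating binomial sums\<close>

text \<open>Up to the sign (-1)^m this is the m-th forward difference of g at 0; with the argument
  \<open>\<lambda>k. g (n + k)\<close> it is the difference at n. The ring is left open because the
  sums occur with real and with complex values.\<close>

definition alt_sum :: "nat \<Rightarrow> (nat \<Rightarrow> 'a::comm_ring_1) \<Rightarrow> 'a" where
  "alt_sum m g = (\<Sum>k\<le>m. (-1) ^ k * of_nat (m choose k) * g k)"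

lemma alt_sum_0 [simp]: "alt_sum 0 g = g 0"
  by (simp add: alt_sum_def)

text \<open>Pascal's rule splits each coefficient in two. One half keeps the order m because
  \<open>m choose Suc m\<close> is 0, the other is the same sum for the shifted sequence. All
  inductions on the order rest on this recursion.\<close>

lemma alt_sum_Suc: "alt_sum (Suc m) g = alt_sum m g - alt_sum m (\<lambda>k. g (Suc k))"
proof -
  have "alt_sum (Suc m) g = g 0 + (\<Sum>k\<le>m. (-1) ^ Suc k * of_nat (Suc m choose Suc k) * g (Suc k))"
    unfolding alt_sum_def by (subst sum.atMost_Suc_shift) simp
  also have "\<dots> = (g 0 + (\<Sum>k\<le>m. (-1) ^ Suc k * of_nat (m choose Suc k) * g (Suc k)))
      - alt_sum m (\<lambda>k. g (Suc k))"
    unfolding alt_sum_def by (simp add: algebra_simps sum.distrib sum_negf sum_subtractf)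
  also have "g 0 + (\<Sum>k\<le>m. (-1) ^ Suc k * of_nat (m choose Suc k) * g (Suc k))
      = (\<Sum>k\<le>Suc m. (-1) ^ k * of_nat (m choose k) * g k)"
    by (subst sum.atMost_Suc_shift) simp
  also have "\<dots> = alt_sum m g"
    by (simp add: alt_sum_def binomial_eq_0)
  finally show ?thesis .
qed

lemma alt_sum_add: "alt_sum m (\<lambda>k. f k + g k) = alt_sum m f + alt_sum m g"
  by (simp add: alt_sum_def distrib_left sum.distrib)

lemma alt_sum_diff: "alt_sum m (\<lambda>k. f k - g k) = alt_sum m f - alt_sum m g"
  by (simp add: alt_sum_def right_diff_distrib sum_subtractf)

lemma alt_sum_cmult: "alt_sum m (\<lambda>k. c * f k) = c * alt_sum m f"
  by (simp add: alt_sum_def sum_distrib_left mult_ac)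

lemma alt_sum_of_real:
  "alt_sum m (\<lambda>k. complex_of_real (f k)) = complex_of_real (alt_sum m f)"
  by (simp add: alt_sum_def)

lemma Re_alt_sum: "Re (alt_sum m f) = alt_sum m (\<lambda>k. Re (f k))"
proof -
  have *: "(-1) ^ k * of_nat n = complex_of_real ((-1) ^ k * of_nat n)" for k n
    by simp
  show ?thesis
    unfolding alt_sum_def Re_sum * by (simp only: Re_complex_of_real times_complex.sel Im_complex_of_real) simp
qed

text \<open>Passing from p(x) to p(x) - p(x + 1) lowers the degree, so m such steps annihilate p.
  The zero polynomial is listed separately because \<open>degree 0 = 0\<close> would hide that its
  degree drops below every m.\<close>

lemma alt_sum_poly_eq_0:
  fixes p :: "'a::idom poly"
  assumes "p = 0 \<or> degree p < m"
  shows "alt_sum m (\<lambda>k. poly p (of_nat (n + k))) = 0"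
  using assms
proof (induction m arbitrary: p)
  case 0
  then show ?case by simp
next
  case (Suc m)
  define r where "r = p - pcompose p [:1, 1:]"
  have r: "poly r x = poly p x - poly p (x + 1)" for x
    by (simp add: r_def poly_pcompose add.commute)
  have deg: "r = 0 \<or> degree r < m"
  proof (cases "degree p = 0")
    case True
    then show ?thesis by (auto simp: r_def elim: degree_eq_zeroE)
  next
    case False
    \<comment> \<open>Composition with x + 1 preserves the degree and, since the inner leading
      coefficient is 1, also the leading coefficient; the top terms cancel.\<close>
    have "coeff r k = 0" if "k \<ge> degree p" for k
    proof (cases "k = degree p")
      case True
      then show ?thesis
        using lead_coeff_comp[of "[:1, 1:]" p] by (simp add: r_def degree_pcompose)
    next
      case False
      with that show ?thesis
        by (simp add: r_def coeff_eq_0 degree_pcompose)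
    qed
    with False have "degree r < degree p"
      by (intro degree_lessI) auto
    with False Suc.prems show ?thesis by auto
  qed
  have rk: "poly p (of_nat (n + k)) - poly p (of_nat (n + Suc k)) = poly r (of_nat (n + k))" for k
    by (simp add: r ac_simps)
  have "alt_sum (Suc m) (\<lambda>k. poly p (of_nat (n + k)))
      = alt_sum m (\<lambda>k. poly p (of_nat (n + k)) - poly p (of_nat (n + Suc k)))"
    by (simp only: alt_sum_Suc alt_sum_diff)
  also have "\<dots> = alt_sum m (\<lambda>k. poly r (of_nat (n + k)))"
    by (simp only: rk)
  also have "\<dots> = 0"
    using deg by (rule Suc.IH)
  finally show ?case .
qed

text \<open>Newton's forward difference formula. The first difference of g satisfies the hypothesis
  with order one less, so it has an expansion, which is then summed back to g.\<close>

lemma newton_expansion: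
  fixes g :: "nat \<Rightarrow> 'a::comm_ring_1"
  assumes "\<And>n. alt_sum m (\<lambda>k. g (n + k)) = 0"
  shows "\<exists>c. \<forall>n. g n = (\<Sum>k<m. c k * of_nat (n choose k))"
  using assms
proof (induction m arbitrary: g)
  case 0
  then show ?case by simp
next
  case (Suc m)
  have "alt_sum m (\<lambda>k. g (n + k) - g (Suc (n + k))) = 0" for n
    using Suc.prems[of n] by (simp add: alt_sum_Suc alt_sum_diff)
  then obtain c where c: "\<And>n. g n - g (Suc n) = (\<Sum>k<m. c k * of_nat (n choose k))"
    using Suc.IH[of "\<lambda>n. g n - g (Suc n)"] by auto
  \<comment> \<open>Summation turns \<open>n choose k\<close> into \<open>n choose Suc k\<close>,
    hence the index shift. The sign comes from the difference being \<open>g n - g (Suc n)\<close>,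
    and \<open>g 0\<close> is the constant of summation.\<close>
  define c' where "c' k = (case k of 0 \<Rightarrow> g 0 | Suc j \<Rightarrow> - c j)" for k
  have "g n = (\<Sum>k<Suc m. c' k * of_nat (n choose k))" for n
  proof (induction n)
    case 0
    then show ?case by (simp add: sum.lessThan_Suc_shift c'_def del: sum.lessThan_Suc)
  next
    case (Suc n)
    have "g (Suc n) = g n - (\<Sum>k<m. c k * of_nat (n choose k))"
      unfolding c[symmetric] by simp
    also have "\<dots> = (\<Sum>k<Suc m. c' k * of_nat (Suc n choose k))"
      unfolding Suc.IH sum.lessThan_Suc_shift
      by (simp add: c'_def algebra_simps sum.distrib sum_negf sum_subtractf)
    finally show ?case .
  qed
  then show ?case by blast
qed

text \<open>The witness is the falling factorial x(x - 1)...(x - k + 1) divided by k!.\<close>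

lemma binomial_poly:
  "\<exists>p :: 'a::field_char_0 poly. degree p \<le> k \<and> (\<forall>n. of_nat (n choose k) = poly p (of_nat n))"
proof (intro exI conjI allI)
  let ?q = "\<Prod>i<k. [:- of_nat i, 1:] :: 'a poly"
  let ?p = "smult (inverse (fact k)) ?q"
  have "degree ?q \<le> sum (degree \<circ> (\<lambda>i. [:- of_nat i, 1:] :: 'a poly)) {..<k}"
    by (rule degree_prod_sum_le) simp
  then show "degree ?p \<le> k"
    by (simp add: comp_def)
  fix n
  have "of_nat (n choose k) = (of_nat n gchoose k :: 'a)"
    by (rule binomial_gbinomial)
  also have "\<dots> = poly ?p (of_nat n)"
    by (simp add: gbinomial_prod_rev poly_prod atLeast0LessThan field_simps)
  finally show "of_nat (n choose k) = poly ?p (of_nat n)" .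
qed

text \<open>One direction is Newton's formula with binomial coefficients read as polynomials; the
  other is annihilation by differences. Order \<open>Suc d\<close> matches degree at most d, a bound
  that the zero polynomial also meets.\<close>

lemma alt_sum_eq_0_iff_poly:
  fixes g :: "nat \<Rightarrow> 'a::field_char_0"
  shows "(\<forall>n. alt_sum (Suc d) (\<lambda>k. g (n + k)) = 0) \<longleftrightarrow>
    (\<exists>p. degree p \<le> d \<and> (\<forall>n. g n = poly p (of_nat n)))"
proof
  assume "\<forall>n. alt_sum (Suc d) (\<lambda>k. g (n + k)) = 0"
  then obtain c where c: "\<And>n. g n = (\<Sum>k<Suc d. c k * of_nat (n choose k))"
    using newton_expansion[of "Suc d" g] by blast
  obtain P :: "nat \<Rightarrow> 'a poly" where P: "\<And>k. degree (P k) \<le> k"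
      "\<And>k n. of_nat (n choose k) = poly (P k) (of_nat n)"
    using binomial_poly by metis
  show "\<exists>p. degree p \<le> d \<and> (\<forall>n. g n = poly p (of_nat n))"
  proof (intro exI conjI allI)
    show "degree (\<Sum>k<Suc d. smult (c k) (P k)) \<le> d"
      by (intro degree_sum_le) (auto intro: order_trans[OF degree_smult_le] order_trans[OF P(1)])
    show "g n = poly (\<Sum>k<Suc d. smult (c k) (P k)) (of_nat n)" for n
      by (simp add: c P(2) poly_sum)
  qed
next
  assume "\<exists>p. degree p \<le> d \<and> (\<forall>n. g n = poly p (of_nat n))"
  then obtain p where "degree p \<le> d" "\<And>n. g n = poly p (of_nat n)"
    by blast
  then show "\<forall>n. alt_sum (Suc d) (\<lambda>k. g (n + k)) = 0"
    using alt_sum_poly_eq_0[of p "Suc d"] by simp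
qed

text \<open>The polynomials agree at more points than their degrees allow. This makes the degree a
  property of the sequence.\<close>

lemma poly_eq_of_nat:
  fixes p q :: "'a::{comm_ring_1,ring_char_0,ring_no_zero_divisors} poly"
  assumes "\<And>n. poly p (of_nat n) = poly q (of_nat n)"
  shows "p = q"
proof (rule poly_eqI_degree)
  let ?A = "of_nat ` {..max (degree p) (degree q)} :: 'a set"
  show "poly p x = poly q x" if "x \<in> ?A" for x
    using that assms by auto
  have "card ?A = Suc (max (degree p) (degree q))"
    by (subst card_image) (auto simp: inj_on_def)
  then show "degree p < card ?A" "degree q < card ?A"
    by auto
qed


section \<open>Adjoints on closed subspaces\<close>

text \<open>
  A minimizing sequence of \<open>(norm x)\<^sup>2 - 2 * f x\<close> over \<open>M\<close> is Cauchy by the parallelogram law, and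
  the first-order condition at its limit is the representation.
\<close>

lemma riesz_representation:
  fixes f :: "'a::{real_inner,complete_space} \<Rightarrow> real"
  assumes f: "bounded_linear f" and M: "subspace M" "closed M"
  shows "\<exists>z\<in>M. \<forall>x\<in>M. f x = inner x z"
proof -
  interpret f: bounded_linear f by (rule f)
  define F where "F x = (norm x)\<^sup>2 - 2 * f x" for x
  obtain K where K: "\<And>x. norm (f x) \<le> norm x * K"
    using f.bounded by blast
  \<comment> \<open>Completing the square in \<open>norm x\<close> bounds F from below, so its
    infimum over M exists.\<close>
  have low: "F x \<ge> - K\<^sup>2" for x
  proof -
    have "F x \<ge> (norm x)\<^sup>2 - 2 * (norm x * K)"
      using K[of x] by (simp add: F_def)
    also have "(norm x)\<^sup>2 - 2 * (norm x * K) = (norm x - K)\<^sup>2 - K\<^sup>2"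
      by (simp add: power2_eq_square algebra_simps)
    finally show ?thesis
      using zero_le_power2[of "norm x - K"] by linarith
  qed
  have bdd: "bdd_below (F ` M)"
    using low by (intro bdd_belowI2)
  have ne: "F ` M \<noteq> {}"
    using M(1) subspace_0 by blast
  define I where "I = Inf (F ` M)"
  have I: "I \<le> F x" if "x \<in> M" for x
    unfolding I_def using bdd that by (intro cInf_lower) auto
  have "\<exists>x\<in>M. F x < I + inverse (Suc n)" for n
  proof -
    have "I < I + inverse (Suc n)" by simp
    then show ?thesis
      unfolding I_def using cInf_lessD[OF ne] by (metis (no_types, lifting) imageE)
  qed
  then obtain X where X: "\<And>n. X n \<in> M" "\<And>n. F (X n) < I + inverse (Suc n)"
    by metis
  \<comment> \<open>The parallelogram law in terms of F: the contributions of f cancel by linearity.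
    The midpoint stays in M, where F is at least I.\<close>
  have par: "(norm (a - b))\<^sup>2 = 2 * F a + 2 * F b - 4 * F ((1/2) *\<^sub>R (a + b))" for a b
  proof -
    have "4 * (norm ((1/2) *\<^sub>R (a + b)))\<^sup>2 = (norm (a + b))\<^sup>2"
      by (simp add: power2_eq_square)
    moreover have "(norm (a - b))\<^sup>2 + (norm (a + b))\<^sup>2 = 2 * (norm a)\<^sup>2 + 2 * (norm b)\<^sup>2"
      by (simp add: power2_norm_eq_inner algebra_simps inner_commute)
    ultimately show ?thesis
      by (simp add: F_def f.scaleR f.add field_simps)
  qed
  have "Cauchy X"
  proof (rule metric_CauchyI)
    fix e :: real assume "e > 0"
    then have "e\<^sup>2 / 4 > 0" by simp
    \<comment> \<open>Each of the two values of F exceeds I by less than e^2/4 and enters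
      \<open>par\<close> with factor 2, which totals e^2.\<close>
    then obtain N where N: "inverse (of_nat (Suc N)) < e\<^sup>2 / 4"
      using reals_Archimedean by blast
    have "dist (X i) (X j) < e" if "i \<ge> N" "j \<ge> N" for i j
    proof -
      have *: "F (X i) < I + e\<^sup>2 / 4" if "i \<ge> N" for i
      proof -
        have "inverse (real (Suc i)) \<le> inverse (real (Suc N))"
          using that by (simp add: le_imp_inverse_le)
        then show ?thesis
          using X(2)[of i] N by linarith
      qed
      have "I \<le> F ((1/2) *\<^sub>R (X i + X j))"
        using M(1) X(1) by (intro I subspace_scale subspace_add)
      then have "(norm (X i - X j))\<^sup>2 < e\<^sup>2"
        using par[of "X i" "X j"] *[OF that(1)] *[OF that(2)] by linarith
      then show ?thesis
        using \<open>e > 0\<close> by (simp add: dist_norm power2_less_imp_less)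
    qed
    then show "\<exists>N. \<forall>i\<ge>N. \<forall>j\<ge>N. dist (X i) (X j) < e"
      by blast
  qed
  then obtain z where z: "X \<longlonglongrightarrow> z"
    using Cauchy_convergent convergent_def by blast
  have zM: "z \<in> M"
    using M(2) X(1) z closed_sequentially by blast
  have "(\<lambda>n. F (X n)) \<longlonglongrightarrow> F z"
    unfolding F_def by (intro tendsto_intros z f.tendsto)
  moreover have "(\<lambda>n. I + inverse (real (Suc n))) \<longlonglongrightarrow> I + 0"
    by (intro tendsto_intros LIMSEQ_inverse_real_of_nat)
  ultimately have "F z \<le> I + 0"
    by (rule LIMSEQ_le) (use X(2) less_imp_le in blast)
  then have min: "F z \<le> F x" if "x \<in> M" for x
    using I[OF that] by simp
  have "f x = inner x z" if "x \<in> M" for x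
  proof -
    define d where "d = inner x z - f x"
    have quad: "0 \<le> t\<^sup>2 * (norm x)\<^sup>2 + 2 * t * d" for t
    proof -
      have "F z \<le> F (z + t *\<^sub>R x)"
        using M(1) zM that by (intro min subspace_add subspace_scale)
      also have "F (z + t *\<^sub>R x) = F z + t\<^sup>2 * (norm x)\<^sup>2 + 2 * t * d"
        unfolding F_def d_def power2_norm_eq_inner
        by (simp add: f.add f.scaleR algebra_simps inner_commute power2_eq_square)
      finally show ?thesis by simp
    qed
    have "d = 0"
    proof (rule ccontr)
      assume "d \<noteq> 0"
      \<comment> \<open>The added 1 keeps s positive even for x = 0. At t = -d/s the linear term of
        \<open>quad\<close> outweighs the quadratic one, so its value is negative.\<close>
      define s where "s = (norm x)\<^sup>2 + 1"
      have s: "s > 0" "(norm x)\<^sup>2 < 2 * s"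
        by (simp_all add: s_def add_nonneg_pos)
      have "(d / s)\<^sup>2 * (norm x)\<^sup>2 + 2 * (- (d / s)) * d = (d\<^sup>2 / s\<^sup>2) * ((norm x)\<^sup>2 - 2 * s)"
        using s(1) by (simp add: field_simps power2_eq_square)
      also have "\<dots> < 0"
        using s \<open>d \<noteq> 0\<close> by (intro mult_pos_neg) auto
      finally show False
        using quad[of "- (d / s)"] by simp
    qed
    then show ?thesis by (simp add: d_def)
  qed
  with zM show ?thesis by blast
qed

section \<open>Complex scalars, closed complex subspaces and the adjoint\<close>

lemma cinner_scaleC_right: "cinner x (c *\<^sub>C y) = cnj c * cinner x y"
  by (metis cinner_commute cinner_scaleC_left complex_cnj_mult)

lemma cinner_zero_left [simp]: "cinner 0 x = 0"
  using cinner_scaleC_left[of 0 0 x] by simp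

lemma cinner_sum_left: "cinner (sum f A) y = (\<Sum>x\<in>A. cinner (f x) y)"
  by (induction A rule: infinite_finite_induct) (simp_all add: cinner_add_left)

lemma cinner_self: "cinner x x = complex_of_real ((norm x)\<^sup>2)"
proof (rule complex_eqI)
  show "Im (cinner x x) = Im (complex_of_real ((norm x)\<^sup>2))"
    using arg_cong[OF cinner_commute[of x x], of Im] by simp
qed (simp add: inner_Re_cinner[symmetric] power2_norm_eq_inner)

lemma norm_scaleC: "norm (c *\<^sub>C (x::'a::complex_inner)) = cmod c * norm x"
proof -
  have "complex_of_real ((norm (c *\<^sub>C x))\<^sup>2) = (c * cnj c) * cinner x x"
    unfolding cinner_self[symmetric] cinner_scaleC_left cinner_scaleC_right
    by (simp only: mult.assoc mult.left_commute)
  also have "\<dots> = complex_of_real ((cmod c * norm x)\<^sup>2)"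
    by (simp add: cinner_self power_mult_distrib flip: complex_norm_square)
  finally have "complex_of_real ((norm (c *\<^sub>C x))\<^sup>2) = complex_of_real ((cmod c * norm x)\<^sup>2)" .
  then have "(norm (c *\<^sub>C x))\<^sup>2 = (cmod c * norm x)\<^sup>2"
    using of_real_eq_iff by blast
  then show ?thesis
    by (rule power2_eq_imp_eq) auto
qed

lemma bounded_linear_scaleC: "bounded_linear (\<lambda>x. c *\<^sub>C (x::'a::complex_inner))"
proof (rule bounded_linear_intro[where K = "cmod c"])
  show "c *\<^sub>C r *\<^sub>R x = r *\<^sub>R c *\<^sub>C x" for r and x :: 'a
    by (simp add: scaleR_scaleC scaleC_scaleC mult.commute)
qed (simp_all add: scaleC_add_right norm_scaleC)

lemma csubspace_imp_subspace: "csubspace M \<Longrightarrow> subspace M"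
  by (simp add: subspace_def complex_vector.subspace_def scaleR_scaleC)

lemma csubspace_closure:
  fixes M :: "'a::complex_inner set"
  assumes "csubspace M"
  shows "csubspace (closure M)"
proof (rule complex_vector.subspaceI)
  show "0 \<in> closure M"
    using assms closure_subset[of M] by (auto simp: complex_vector.subspace_def)
  show "x + y \<in> closure M" if xy: "x \<in> closure M" "y \<in> closure M" for x y
  proof -
    obtain f g where fg: "\<And>n. f n \<in> M" "f \<longlonglongrightarrow> x" "\<And>n. g n \<in> M" "g \<longlonglongrightarrow> y"
      using xy unfolding closure_sequential by blast
    have "f n + g n \<in> M" for n
      using assms fg by (simp add: complex_vector.subspace_def)
    with tendsto_add[OF fg(2,4)] show ?thesis
      unfolding closure_sequential by (intro exI[of _ "\<lambda>n. f n + g n"]) simp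
  qed
  have "(\<lambda>x. c *\<^sub>C x) ` closure M \<subseteq> closure M" for c
  proof (rule image_closure_subset)
    show "continuous_on (closure M) (\<lambda>x. c *\<^sub>C x)"
      by (rule linear_continuous_on[OF bounded_linear_scaleC])
    show "(\<lambda>x. c *\<^sub>C x) ` M \<subseteq> closure M"
      using assms closure_subset[of M] by (auto simp: complex_vector.subspace_def)
  qed simp
  then show "\<And>c x. x \<in> closure M \<Longrightarrow> c *\<^sub>C x \<in> closure M"
    by blast
qed

lemma bounded_clinear_funpow:
  fixes T :: "'a::complex_inner \<Rightarrow> 'a"
  assumes "bounded_clinear T"
  shows "bounded_clinear (T ^^ n)"
proof (induction n)
  case 0
  have id: "T ^^ 0 = (\<lambda>x. x)" by auto
  show ?case
    unfolding id bounded_clinear_def by (simp add: bounded_linear_ident)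
next
  case (Suc n)
  then show ?case
    using assms bounded_linear_compose[of T "T ^^ n"] by (simp add: bounded_clinear_def comp_def)
qed

lemma funpow_in_invariant:
  assumes "T ` M \<subseteq> M" "x \<in> M"
  shows "(T ^^ n) x \<in> M"
  using assms by (induction n) auto

text \<open>Riesz representation of the real functional \<open>\<lambda>x. inner (T x) y\<close> on
  M gives equality of real parts; inserting \<open>\<i> *\<^sub>C x\<close>, which lies in M as
  well, gives the imaginary parts.\<close>

lemma cadjoint_on:
  fixes T :: "'a::chilbert_space \<Rightarrow> 'a"
  assumes T: "bounded_clinear T" and M: "csubspace M" "closed M"
  shows "cadjoint_on M T y \<in> M"
    and "x \<in> M \<Longrightarrow> cinner (T x) y = cinner x (cadjoint_on M T y)"
proof -
  have "bounded_linear (\<lambda>x. inner (T x) y)"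
    using T bounded_linear_compose[OF bounded_linear_inner_left, of T y]
    by (simp add: bounded_clinear_def)
  then obtain z where z: "z \<in> M" "\<And>x. x \<in> M \<Longrightarrow> inner (T x) y = inner x z"
    using riesz_representation[of "\<lambda>x. inner (T x) y" M] csubspace_imp_subspace M by blast
  have eq: "cinner (T x) y = cinner x z" if "x \<in> M" for x
  proof (rule complex_eqI)
    show "Re (cinner (T x) y) = Re (cinner x z)"
      using z(2)[OF that] by (simp add: inner_Re_cinner)
    have "\<i> *\<^sub>C x \<in> M"
      using M(1) that by (simp add: complex_vector.subspace_def)
    from z(2)[OF this] show "Im (cinner (T x) y) = Im (cinner x z)"
      using T by (simp add: bounded_clinear_def inner_Re_cinner cinner_scaleC_left)
  qed
  have *: "cadjoint_on M T y = z"
    by (rule cadjoint_on_eqI[OF M(1) z(1) eq])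
  show "cadjoint_on M T y \<in> M"
    using z(1) * by simp
  show "x \<in> M \<Longrightarrow> cinner (T x) y = cinner x (cadjoint_on M T y)"
    using eq * by simp
qed

text \<open>The outermost T moves across first, which changes y into its adjoint image; hence the
  induction is over all y in M and carries membership along. Invariance keeps the iterates of x in
  M, where the adjoint identity holds.\<close>

lemma cadjoint_on_funpow:
  fixes T :: "'a::chilbert_space \<Rightarrow> 'a"
  assumes T: "bounded_clinear T" and M: "csubspace M" "closed M" "T ` M \<subseteq> M"
    and "x \<in> M" "y \<in> M"
  shows "(cadjoint_on M T ^^ k) y \<in> M \<and>
    cinner ((T ^^ k) x) y = cinner x ((cadjoint_on M T ^^ k) y)"
  using \<open>y \<in> M\<close>
proof (induction k arbitrary: y)
  case 0
  then show ?case by simp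
next
  case (Suc k)
  have "(T ^^ k) x \<in> M"
    using M(3) \<open>x \<in> M\<close> by (rule funpow_in_invariant)
  then show ?case
    using Suc.IH[OF cadjoint_on(1)[OF T M(1,2)], of y]
      cadjoint_on(2)[OF T M(1,2), of "(T ^^ k) x" y]
    unfolding funpow_Suc_right[of k "cadjoint_on M T"] by simp
qed


section \<open>The defect form\<close>

text \<open>The right-hand side does not mention M. Hence one and the same form decides the property
  on the whole space and on every closed invariant subspace.\<close>

lemma cinner_defect_on:
  fixes T :: "'a::chilbert_space \<Rightarrow> 'a"
  assumes T: "bounded_clinear T" and M: "csubspace M" "closed M" "T ` M \<subseteq> M"
    and h: "h \<in> M" and g: "g \<in> M"
  shows "cinner (defect_on M m T h) g = alt_sum m (\<lambda>k. cinner ((T ^^ k) h) ((T ^^ k) g))"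
proof -
  have "cinner ((cadjoint_on M T ^^ k) ((T ^^ k) h)) g = cinner ((T ^^ k) h) ((T ^^ k) g)" for k
    using cadjoint_on_funpow[OF T M g funpow_in_invariant[OF M(3) h]] cinner_commute by metis
  then show ?thesis
    by (simp add: defect_on_def alt_sum_def cinner_sum_left cinner_scaleC_left)
qed

lemma cinner_defect_on_self:
  fixes T :: "'a::chilbert_space \<Rightarrow> 'a"
  assumes "bounded_clinear T" "csubspace M" "closed M" "T ` M \<subseteq> M" "h \<in> M"
  shows "cinner (defect_on M m T h) h = alt_sum m (orbit_norm_sq T h)"
  unfolding cinner_defect_on[OF assms assms(5)]
  by (rule arg_cong[where f = "alt_sum m"]) (simp add: fun_eq_iff orbit_norm_sq_def cinner_self)

lemma defect_on_in:
  fixes T :: "'a::chilbert_space \<Rightarrow> 'a"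
  assumes T: "bounded_clinear T" and M: "csubspace M" "closed M" "T ` M \<subseteq> M" and h: "h \<in> M"
  shows "defect_on M m T h \<in> M"
  unfolding defect_on_def
  using cadjoint_on_funpow[OF T M h funpow_in_invariant[OF M(3) h]] M(1)
  by (intro complex_vector.subspace_sum complex_vector.subspace_scale) auto

text \<open>Polarization: if the quadratic form vanishes at h, g and h + g, then the real part of
  the sesquilinear form vanishes at (h, g).\<close>

lemma m_isometry_on_iff:
  fixes T :: "'a::chilbert_space \<Rightarrow> 'a"
  assumes T: "bounded_clinear T" and M: "csubspace M" "closed M" "T ` M \<subseteq> M"
  shows "m_isometry_on M m T \<longleftrightarrow> m \<ge> 1 \<and> (\<forall>h\<in>M. alt_sum m (orbit_norm_sq T h) = 0)"
proof
  assume "m_isometry_on M m T"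
  then show "m \<ge> 1 \<and> (\<forall>h\<in>M. alt_sum m (orbit_norm_sq T h) = 0)"
    using cinner_defect_on_self[OF T M, of _ m] by (auto simp: m_isometry_on_def)
next
  assume R: "m \<ge> 1 \<and> (\<forall>h\<in>M. alt_sum m (orbit_norm_sq T h) = 0)"
  have "defect_on M m T h = 0" if h: "h \<in> M" for h
  proof -
    \<comment> \<open>Testing against the defect vector itself turns the vanishing inner product
      into its squared norm.\<close>
    define g where "g = defect_on M m T h"
    have g: "g \<in> M"
      unfolding g_def by (rule defect_on_in[OF T M h])
    have hg: "h + g \<in> M"
      using M(1) h g by (simp add: complex_vector.subspace_def)
    have lin: "(T ^^ k) (h + g) = (T ^^ k) h + (T ^^ k) g" for k
      using bounded_clinear_funpow[OF T] bounded_linear.linear linear_add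
      by (metis bounded_clinear_def)
    have "orbit_norm_sq T (h + g) k = orbit_norm_sq T h k + orbit_norm_sq T g k
        + 2 * complex_of_real (inner ((T ^^ k) h) ((T ^^ k) g))" for k
      by (simp add: orbit_norm_sq_def lin power2_norm_eq_inner inner_add_left inner_add_right
          inner_commute)
    then have "alt_sum m (orbit_norm_sq T (h + g)) = alt_sum m (orbit_norm_sq T h)
        + alt_sum m (orbit_norm_sq T g)
        + 2 * alt_sum m (\<lambda>k. complex_of_real (inner ((T ^^ k) h) ((T ^^ k) g)))"
      by (subst arg_cong[where f = "alt_sum m", OF ext]) (auto simp: alt_sum_add alt_sum_cmult)
    then have "alt_sum m (\<lambda>k. inner ((T ^^ k) h) ((T ^^ k) g)) = 0"
      using R h g hg by (simp add: alt_sum_of_real)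
    then have "inner (defect_on M m T h) g = 0"
      by (simp add: inner_Re_cinner cinner_defect_on[OF T M h g] Re_alt_sum)
    then show ?thesis
      by (simp add: g_def)
  qed
  with R show "m_isometry_on M m T"
    by (simp add: m_isometry_on_def)
qed

lemma m_isometry_iff:
  fixes T :: "'a::chilbert_space \<Rightarrow> 'a"
  assumes "bounded_clinear T"
  shows "m_isometry m T \<longleftrightarrow> m \<ge> 1 \<and> (\<forall>h. alt_sum m (orbit_norm_sq T h) = 0)"
  using m_isometry_on_iff[OF assms complex_vector.subspace_UNIV] by simp

section \<open>Zero sets of the defect form and Baire category\<close>

lemma continuous_on_alt_sum_orbit:
  assumes "bounded_clinear T"
  shows "continuous_on A (\<lambda>h. alt_sum m (orbit_norm_sq T h))"
proof -
  have "continuous_on A (T ^^ k)" for k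
    using bounded_clinear_funpow[OF assms] by (simp add: bounded_clinear_def linear_continuous_on)
  then show ?thesis
    unfolding alt_sum_def orbit_norm_sq_def by (intro continuous_intros)
qed

lemma closed_alt_sum_orbit_eq_0:
  assumes "bounded_clinear T"
  shows "closed {h. alt_sum m (orbit_norm_sq T h) = 0}"
  by (intro closed_Collect_eq continuous_on_alt_sum_orbit[OF assms] continuous_on_const)

text \<open>Moving along the orbit shifts the sequence, so values of the form at the points
  \<open>(T ^^ n) h\<close> are differences of a single sequence at n.\<close>

lemma orbit_norm_sq_funpow: "orbit_norm_sq T ((T ^^ n) h) = (\<lambda>k. orbit_norm_sq T h (n + k))"
proof
  fix k
  have "(T ^^ k) ((T ^^ n) h) = (T ^^ (n + k)) h"
    by (metis add.commute comp_apply funpow_add)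
  then show "orbit_norm_sq T ((T ^^ n) h) k = orbit_norm_sq T h (n + k)"
    by (simp add: orbit_norm_sq_def)
qed

text \<open>By the parallelogram law, a quadratic form that vanishes at \<open>h - x\<close>, \<open>h\<close> and \<open>h + x\<close> vanishes at \<open>x\<close>.\<close>

lemma alt_sum_orbit_eq_0_of_interior:
  fixes T :: "'a::complex_inner \<Rightarrow> 'a"
  assumes T: "bounded_clinear T"
    and int: "interior {h. alt_sum m (orbit_norm_sq T h) = 0} \<noteq> {}"
  shows "alt_sum m (orbit_norm_sq T x) = 0"
proof (cases "x = 0")
  case True
  have "(T ^^ k) 0 = 0" for k
    using bounded_clinear_funpow[OF T] bounded_linear.linear linear_0
    by (metis bounded_clinear_def)
  with True show ?thesis
    by (simp add: alt_sum_def orbit_norm_sq_def)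
next
  case False
  obtain c where "c \<in> interior {h. alt_sum m (orbit_norm_sq T h) = 0}"
    using int by auto
  then obtain e where e: "e > 0" and ball: "\<And>h. h \<in> ball c e \<Longrightarrow> alt_sum m (orbit_norm_sq T h) = 0"
    unfolding mem_interior by (auto simp del: mem_ball)
  \<comment> \<open>With x nonzero this gives \<open>norm (t *\<^sub>R x)\<close> the value e/2, so
    both points c + tx and c - tx lie in the ball.\<close>
  define t where "t = e / (2 * norm x)"
  have t: "t > 0" "norm (t *\<^sub>R x) < e"
    using e False by (simp_all add: t_def)
  have lin: "(T ^^ k) (c + t *\<^sub>R x) = (T ^^ k) c + t *\<^sub>R (T ^^ k) x"
      "(T ^^ k) (c - t *\<^sub>R x) = (T ^^ k) c - t *\<^sub>R (T ^^ k) x" for k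
  proof -
    interpret Tk: bounded_linear "T ^^ k"
      using bounded_clinear_funpow[OF T] by (simp add: bounded_clinear_def)
    show "(T ^^ k) (c + t *\<^sub>R x) = (T ^^ k) c + t *\<^sub>R (T ^^ k) x"
      "(T ^^ k) (c - t *\<^sub>R x) = (T ^^ k) c - t *\<^sub>R (T ^^ k) x"
      by (simp_all only: Tk.add Tk.diff Tk.scaleR)
  qed
  have "(norm (a + t *\<^sub>R b))\<^sup>2 + (norm (a - t *\<^sub>R b))\<^sup>2 = 2 * (norm a)\<^sup>2 + 2 * t\<^sup>2 * (norm b)\<^sup>2"
    for a b :: 'a
    unfolding power2_norm_eq_inner
    by (simp add: inner_add_left inner_add_right inner_diff_left inner_diff_right power2_eq_square)
      (simp add: algebra_simps)
  then have quad: "orbit_norm_sq T (c + t *\<^sub>R x) k + orbit_norm_sq T (c - t *\<^sub>R x) k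
      = 2 * orbit_norm_sq T c k + (2 * (complex_of_real t)\<^sup>2) * orbit_norm_sq T x k" for k
    unfolding orbit_norm_sq_def lin of_real_add[symmetric] by simp
  have "alt_sum m (\<lambda>k. orbit_norm_sq T (c + t *\<^sub>R x) k + orbit_norm_sq T (c - t *\<^sub>R x) k)
      = alt_sum m (\<lambda>k. 2 * orbit_norm_sq T c k + (2 * (complex_of_real t)\<^sup>2) * orbit_norm_sq T x k)"
    unfolding quad ..
  moreover have "c + t *\<^sub>R x \<in> ball c e" "c - t *\<^sub>R x \<in> ball c e" "c \<in> ball c e"
    using t e by (simp_all add: dist_norm)
  ultimately have "2 * (complex_of_real t)\<^sup>2 * alt_sum m (orbit_norm_sq T x) = 0"
    unfolding alt_sum_add alt_sum_cmult by (simp add: ball)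
  with t(1) show ?thesis
    by simp
qed

lemma m_isometry_of_interior:
  fixes T :: "'a::chilbert_space \<Rightarrow> 'a"
  assumes "bounded_clinear T" "m \<ge> 1" "interior {h. alt_sum m (orbit_norm_sq T h) = 0} \<noteq> {}"
  shows "m_isometry m T"
  using assms m_isometry_iff alt_sum_orbit_eq_0_of_interior by blast

text \<open>All implications back to (i) pass through this lemma. If no order worked, the countably
  many closed sets \<open>Z m\<close> with m at least 1 would have empty interior, and by
  completeness so would their union, which contains V.\<close>

lemma m_isometry_of_local:
  fixes T :: "'a::chilbert_space \<Rightarrow> 'a"
  assumes T: "bounded_clinear T" and V: "open V" "V \<noteq> {}"
    and loc: "\<And>h. h \<in> V \<Longrightarrow> \<exists>m\<ge>1. alt_sum m (orbit_norm_sq T h) = 0"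
  shows "\<exists>m\<ge>1. m_isometry m T"
proof (rule ccontr)
  assume no: "\<not> (\<exists>m\<ge>1. m_isometry m T)"
  define Z where "Z m = {h. alt_sum m (orbit_norm_sq T h) = 0}" for m
  have "closed (Z m)" "m \<ge> 1 \<Longrightarrow> interior (Z m) = {}" for m
    using closed_alt_sum_orbit_eq_0[OF T] m_isometry_of_interior[OF T, of m] no
    by (auto simp: Z_def)
  then have "euclidean interior_of \<Union> (Z ` {1..}) = {}"
    by (intro Baire_category_alt disjI1 completely_metrizable_space_euclidean) auto
  moreover have "V \<subseteq> \<Union> (Z ` {1..})"
    using loc by (force simp: Z_def)
  ultimately show False
    using V interior_maximal[of V "\<Union> (Z ` {1..})"] by auto
qed


section \<open>Weighted shifts\<close>

text \<open>Writing the weights as quotients \<open>a (Suc n) / a n\<close> makes the product of k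
  consecutive weights telescope. Later \<open>a n\<close> is the norm of
  \<open>(T ^^ n) h\<close>.\<close>

lemma weighted_shift_funpow_nth:
  assumes a: "\<And>n. a n \<noteq> 0" and B: "\<And>n. cmod (a (Suc n) / a n) \<le> B"
  shows "ell2_nth ((weighted_shift (\<lambda>n. a (Suc n) / a n) ^^ k) f) n =
    (if n < k then 0 else a n / a (n - k) * ell2_nth f (n - k))"
proof (induction k arbitrary: n)
  case 0
  then show ?case by (simp add: a)
next
  case (Suc k)
  show ?case
    by (cases n) (simp_all add: weighted_shift(3)[OF B] Suc.IH a)
qed

text \<open>The first k coordinates of the k-th iterate vanish, so the series for its squared norm
  can be reindexed to start at k.\<close>

lemma norm_weighted_shift_funpow:
  assumes a: "\<And>n. a n \<noteq> 0" and B: "\<And>n. cmod (a (Suc n) / a n) \<le> B"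
  shows "(\<lambda>n. (cmod (ell2_nth f n))\<^sup>2 * ((cmod (a (n + k)))\<^sup>2 / (cmod (a n))\<^sup>2)) sums
    (norm ((weighted_shift (\<lambda>n. a (Suc n) / a n) ^^ k) f))\<^sup>2"
proof -
  let ?g = "(weighted_shift (\<lambda>n. a (Suc n) / a n) ^^ k) f"
  have "(\<lambda>n. (cmod (ell2_nth ?g n))\<^sup>2) sums (norm ?g)\<^sup>2"
    unfolding norm_ell2_sq by (rule summable_sums[OF ell2_summable])
  then have "(\<lambda>n. (cmod (ell2_nth ?g (n + k)))\<^sup>2) sums
      ((norm ?g)\<^sup>2 - (\<Sum>n<k. (cmod (ell2_nth ?g n))\<^sup>2))"
    by (subst sums_iff_shift) simp
  then show ?thesis
    by (simp add: weighted_shift_funpow_nth[of a, OF a B] norm_mult norm_divide power_mult_distrib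
        power_divide mult.commute)
qed

text \<open>The finite sum over k is interchanged with the series over n, and the factor free of k
  is pulled out.\<close>

lemma alt_sum_orbit_weighted_shift:
  assumes a: "\<And>n. a n \<noteq> 0" and B: "\<And>n. cmod (a (Suc n) / a n) \<le> B"
  shows "(\<lambda>n. complex_of_real ((cmod (ell2_nth f n))\<^sup>2 / (cmod (a n))\<^sup>2) *
      alt_sum m (\<lambda>k. complex_of_real ((cmod (a (n + k)))\<^sup>2))) sums
    alt_sum m (orbit_norm_sq (weighted_shift (\<lambda>n. a (Suc n) / a n)) f)"
proof -
  have "(\<lambda>n. \<Sum>k\<le>m. (-1) ^ k * of_nat (m choose k) *
      complex_of_real ((cmod (ell2_nth f n))\<^sup>2 * ((cmod (a (n + k)))\<^sup>2 / (cmod (a n))\<^sup>2))) sums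
    alt_sum m (orbit_norm_sq (weighted_shift (\<lambda>n. a (Suc n) / a n)) f)"
    unfolding alt_sum_def orbit_norm_sq_def
    by (intro sums_sum sums_mult sums_of_real norm_weighted_shift_funpow[of a, OF a B])
  then show ?thesis
    by (simp add: alt_sum_def sum_distrib_left mult_ac)
qed

lemma m_isometry_weighted_shift_iff:
  fixes a :: "nat \<Rightarrow> complex"
  assumes a: "\<And>n. a n \<noteq> 0" and B: "\<And>n. cmod (a (Suc n) / a n) \<le> B"
  shows "m_isometry m (weighted_shift (\<lambda>n. a (Suc n) / a n)) \<longleftrightarrow>
    m \<ge> 1 \<and> (\<forall>n. alt_sum m (\<lambda>k. complex_of_real ((cmod (a (n + k)))\<^sup>2)) = 0)"
proof -
  let ?W = "weighted_shift (\<lambda>n. a (Suc n) / a n)"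
  let ?s = "\<lambda>n. alt_sum m (\<lambda>k. complex_of_real ((cmod (a (n + k)))\<^sup>2))"
  have "(\<forall>f. alt_sum m (orbit_norm_sq ?W f) = 0) \<longleftrightarrow> (\<forall>n. ?s n = 0)"
  proof (intro iffI allI)
    fix n assume "\<forall>f. alt_sum m (orbit_norm_sq ?W f) = 0"
    then have "(\<lambda>j. complex_of_real ((cmod (ell2_nth (ell2_basis n) j))\<^sup>2 / (cmod (a j))\<^sup>2) * ?s j) sums 0"
      using alt_sum_orbit_weighted_shift[of a, OF a B, of "ell2_basis n" m] by simp
    \<comment> \<open>A basis vector leaves only the n-th term of the series, which isolates
      \<open>?s n\<close> with a nonzero factor.\<close>
    moreover have "(\<lambda>j. complex_of_real ((cmod (ell2_nth (ell2_basis n) j))\<^sup>2 / (cmod (a j))\<^sup>2) * ?s j) sums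
        (complex_of_real (1 / (cmod (a n))\<^sup>2) * ?s n)"
      using sums_single[of n "\<lambda>j. complex_of_real (1 / (cmod (a j))\<^sup>2) * ?s j"]
      by (rule back_subst[where P = "\<lambda>f. f sums _"]) (auto simp: ell2_basis.rep_eq)
    ultimately have "complex_of_real (1 / (cmod (a n))\<^sup>2) * ?s n = 0"
      using sums_unique2 by blast
    with a[of n] show "?s n = 0"
      by simp
  next
    fix f assume "\<forall>n. ?s n = 0"
    then show "alt_sum m (orbit_norm_sq ?W f) = 0"
      using alt_sum_orbit_weighted_shift[of a, OF a B, of f m] sums_unique2[OF sums_zero]
      by simp
  qed
  then show ?thesis
    using m_isometry_iff[OF weighted_shift(1)[of "\<lambda>n. a (Suc n) / a n" B, OF B]] by simp
qed


section \<open>Characterizations of \<open>m\<close>-isometries\<close>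

lemma poly_seq_degree_le_orbit_iff:
  "poly_seq_degree_le d (orbit_norm_sq T h) \<longleftrightarrow>
    (\<forall>n. alt_sum (Suc d) (orbit_norm_sq T ((T ^^ n) h)) = 0)"
  by (simp add: poly_seq_degree_le_def orbit_norm_sq_funpow alt_sum_eq_0_iff_poly)

lemma poly_seq_iff_degree_le: "poly_seq g \<longleftrightarrow> (\<exists>d. poly_seq_degree_le d g)"
  by (auto simp: poly_seq_def poly_seq_degree_le_def)

text \<open>The values at the naturals determine the polynomial, hence its exact degree. The index
  is a successor so that the zero polynomial is excluded by the degree alone.\<close>

lemma poly_seq_degree_Suc_iff:
  "poly_seq_degree (Suc d) g \<longleftrightarrow> poly_seq_degree_le (Suc d) g \<and> \<not> poly_seq_degree_le d g"
proof
  assume "poly_seq_degree (Suc d) g"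
  then obtain p where p: "degree p = Suc d" "\<And>n. g n = poly p (of_nat n)"
    unfolding poly_seq_degree_def by blast
  have "q = p" if "\<And>n. g n = poly q (of_nat n)" for q
    using that p(2) by (intro poly_eq_of_nat) simp
  then have "\<not> poly_seq_degree_le d g"
    using p(1) unfolding poly_seq_degree_le_def by force
  moreover have "poly_seq_degree_le (Suc d) g"
    unfolding poly_seq_degree_le_def using p by (intro exI[of _ p]) simp
  ultimately show "poly_seq_degree_le (Suc d) g \<and> \<not> poly_seq_degree_le d g"
    by blast
next
  assume "poly_seq_degree_le (Suc d) g \<and> \<not> poly_seq_degree_le d g"
  then obtain p where p: "degree p \<le> Suc d" "\<And>n. g n = poly p (of_nat n)" "\<not> degree p \<le> d"
    unfolding poly_seq_degree_le_def by blast
  then have "p \<noteq> 0 \<and> degree p = Suc d \<and> (\<forall>n. g n = poly p (of_nat n))"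
    by auto
  then show "poly_seq_degree (Suc d) g"
    unfolding poly_seq_degree_def by blast
qed

text \<open>Since h ranges over the whole space, the orbit points \<open>(T ^^ n) h\<close> are
  covered too; conversely n = 0 recovers h.\<close>

lemma m_isometry_iff_poly_seq_degree_le:
  fixes T :: "'a::chilbert_space \<Rightarrow> 'a"
  assumes "bounded_clinear T"
  shows "m_isometry (Suc d) T \<longleftrightarrow> (\<forall>h. poly_seq_degree_le d (orbit_norm_sq T h))"
  unfolding m_isometry_iff[OF assms] poly_seq_degree_le_orbit_iff
  by (metis funpow_0 le_add1 plus_1_eq_Suc)

lemma m_isometry_iff_poly_seq:
  fixes T :: "'a::chilbert_space \<Rightarrow> 'a"
  assumes T: "bounded_clinear T"
  shows "(\<exists>m\<ge>1. m_isometry m T) \<longleftrightarrow> (\<forall>h. poly_seq (orbit_norm_sq T h))"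
proof
  assume "\<exists>m\<ge>1. m_isometry m T"
  then obtain d where "m_isometry (Suc d) T"
    by (metis Suc_le_D One_nat_def)
  then show "\<forall>h. poly_seq (orbit_norm_sq T h)"
    using m_isometry_iff_poly_seq_degree_le[OF T] poly_seq_iff_degree_le by blast
next
  assume P: "\<forall>h. poly_seq (orbit_norm_sq T h)"
  show "\<exists>m\<ge>1. m_isometry m T"
  proof (rule m_isometry_of_local[OF T open_UNIV])
    fix h
    obtain d where "poly_seq_degree_le d (orbit_norm_sq T h)"
      using P poly_seq_iff_degree_le by blast
    \<comment> \<open>The difference at n = 0, whose order depends on h, is what the local criterion
      takes.\<close>
    then have "alt_sum (Suc d) (orbit_norm_sq T ((T ^^ 0) h)) = 0"
      unfolding poly_seq_degree_le_orbit_iff by blast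
    then show "\<exists>m\<ge>1. alt_sum m (orbit_norm_sq T h) = 0"
      by (intro exI[of _ "Suc d"]) simp
  qed simp
qed

lemma m_isometry_iff_local:
  fixes T :: "'a::chilbert_space \<Rightarrow> 'a"
  assumes T: "bounded_clinear T"
  shows "(\<exists>m\<ge>1. m_isometry m T) \<longleftrightarrow>
    (\<exists>V. open V \<and> V \<noteq> {} \<and> (\<forall>h\<in>V. \<exists>m\<ge>1. cinner (defect_on UNIV m T h) h = 0))"
proof -
  have c: "cinner (defect_on UNIV m T h) h = alt_sum m (orbit_norm_sq T h)" for m h
    by (rule cinner_defect_on_self[OF T complex_vector.subspace_UNIV]) auto
  have "\<exists>V. open V \<and> V \<noteq> {} \<and> (\<forall>h\<in>V. \<exists>m\<ge>1. alt_sum m (orbit_norm_sq T h) = 0)"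
    if "m_isometry m T" for m
    using that m_isometry_iff[OF T] by (intro exI[of _ UNIV]) auto
  then show ?thesis
    unfolding c using m_isometry_of_local[OF T] by blast
qed

text \<open>The form on the closed orbit span is the form on the whole space, so a global order
  restricts. Conversely h lies in its own orbit span, which makes the form vanish at h for an order
  depending on h.\<close>

lemma m_isometry_iff_orbit_span:
  fixes T :: "'a::chilbert_space \<Rightarrow> 'a"
  assumes T: "bounded_clinear T"
  shows "(\<exists>m\<ge>1. m_isometry m T) \<longleftrightarrow> (\<forall>h. \<exists>m\<ge>1. m_isometry_on (closure (orbit_span T h)) m T)"
proof -
  have on: "m_isometry_on (closure (orbit_span T h)) m T \<longleftrightarrow>
      m \<ge> 1 \<and> (\<forall>x\<in>closure (orbit_span T h). alt_sum m (orbit_norm_sq T x) = 0)" for h m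
  proof (rule m_isometry_on_iff[OF T _ closed_closure orbit_span_invariant[OF T]])
    show "csubspace (closure (orbit_span T h))"
      unfolding orbit_span_def by (intro csubspace_closure complex_vector.subspace_span)
  qed
  have h: "h \<in> closure (orbit_span T h)" for h
  proof -
    have "(T ^^ 0) h \<in> orbit_span T h"
      unfolding orbit_span_def by (intro complex_vector.span_base rangeI)
    then show ?thesis
      using closure_subset by auto
  qed
  show ?thesis
  proof
    assume "\<exists>m\<ge>1. m_isometry m T"
    then show "\<forall>h. \<exists>m\<ge>1. m_isometry_on (closure (orbit_span T h)) m T"
      using m_isometry_iff[OF T] on by blast
  next
    assume "\<forall>h. \<exists>m\<ge>1. m_isometry_on (closure (orbit_span T h)) m T"
    then show "\<exists>m\<ge>1. m_isometry m T"
      using on h by (intro m_isometry_of_local[OF T open_UNIV]) blast+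
  qed
qed

lemma m_isometry_iff_weighted_shift:
  fixes T :: "'a::chilbert_space \<Rightarrow> 'a"
  assumes T: "bounded_clinear T"
  shows "(\<exists>m\<ge>1. m_isometry m T) \<longleftrightarrow> {x. T x = 0} = {0} \<and>
    (\<forall>h. h \<noteq> 0 \<longrightarrow> (\<exists>m\<ge>1. m_isometry m (weighted_shift
       (\<lambda>n. complex_of_real (norm ((T ^^ (n + 1)) h) / norm ((T ^^ n) h))))))"
    (is "?L \<longleftrightarrow> ?K \<and> ?R")
proof -
  have T0: "T 0 = 0"
    using T bounded_linear.linear linear_0 by (auto simp: bounded_clinear_def)
  obtain B where B: "B \<ge> 0" "\<And>x. norm (T x) \<le> norm x * B"
    using T bounded_linear.nonneg_bounded by (metis bounded_clinear_def)
  have shift: "m_isometry m (weighted_shift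
        (\<lambda>n. complex_of_real (norm ((T ^^ (n + 1)) h) / norm ((T ^^ n) h)))) \<longleftrightarrow>
      m \<ge> 1 \<and> (\<forall>n. alt_sum m (orbit_norm_sq T ((T ^^ n) h)) = 0)"
    if K: ?K and h: "h \<noteq> 0" for m h
  proof -
    have nz: "(T ^^ n) h \<noteq> 0" for n
      using K h by (induction n) auto
    \<comment> \<open>The criterion for shifts with \<open>a n\<close> the norm of
      \<open>(T ^^ n) h\<close>: the trivial kernel makes these nonzero, and the bound B of T bounds
      the weights.\<close>
    have "m_isometry m (weighted_shift (\<lambda>n. complex_of_real (norm ((T ^^ Suc n) h)) /
        complex_of_real (norm ((T ^^ n) h)))) \<longleftrightarrow>
      m \<ge> 1 \<and> (\<forall>n. alt_sum m (\<lambda>k. complex_of_real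
        ((cmod (complex_of_real (norm ((T ^^ (n + k)) h))))\<^sup>2)) = 0)"
    proof (rule m_isometry_weighted_shift_iff)
      show "complex_of_real (norm ((T ^^ n) h)) \<noteq> 0" for n
        using nz by simp
      show "cmod (complex_of_real (norm ((T ^^ Suc n) h)) / complex_of_real (norm ((T ^^ n) h))) \<le> B" for n
        using nz[of n] B(2)[of "(T ^^ n) h"] by (simp add: norm_divide field_simps)
    qed
    then show ?thesis
      unfolding orbit_norm_sq_funpow by (simp add: orbit_norm_sq_def)
  qed
  show ?thesis
  proof
    assume ?L
    then obtain m where m: "m \<ge> 1" "\<And>h. alt_sum m (orbit_norm_sq T h) = 0"
      using m_isometry_iff[OF T] by blast
    \<comment> \<open>For x in the kernel the squared norms are zero from index 1 on, and the term
      at index 0 has coefficient 1, so the alternating sum is the squared norm of x.\<close>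
    have "x = 0" if x: "T x = 0" for x
    proof -
      have "(T ^^ Suc k) x = 0" for k
        by (induction k) (simp_all add: x T0)
      then have "orbit_norm_sq T x k = (if k = 0 then complex_of_real ((norm x)\<^sup>2) else 0)" for k
        by (cases k) (simp_all add: orbit_norm_sq_def)
      then have "alt_sum m (orbit_norm_sq T x) = complex_of_real ((norm x)\<^sup>2)"
        by (simp add: alt_sum_def if_distrib[where f = "\<lambda>x. _ * x"] cong: if_cong)
      then show ?thesis
        using m(2)[of x] by simp
    qed
    then have ?K
      using T0 by auto
    with m shift show "?K \<and> ?R"
      by blast
  next
    assume KR: "?K \<and> ?R"
    show ?L
    proof (rule m_isometry_of_local[OF T open_UNIV])
      fix h
      show "\<exists>m\<ge>1. alt_sum m (orbit_norm_sq T h) = 0"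
      proof (cases "h = 0")
        case True
        then show ?thesis
          by (intro exI[of _ 1]) (simp add: alt_sum_def orbit_norm_sq_def T0)
      next
        case False
        then obtain m where "m \<ge> 1" "alt_sum m (orbit_norm_sq T ((T ^^ 0) h)) = 0"
          using KR shift[of h] by blast
        then show ?thesis
          by auto
      qed
    qed simp
  qed
qed

text \<open>With m = d + 2, the vectors of degree at most d form an intersection over n of closed
  zero sets, contained in the zero set of order m - 1. The latter has empty interior because T is
  not an (m - 1)-isometry. As every vector has degree at most m - 1, the vectors of degree exactly m
  - 1 are the complement.\<close>

lemma strict_m_isometry_poly_seq_degree:
  fixes T :: "'a::chilbert_space \<Rightarrow> 'a"
  assumes T: "bounded_clinear T" and "m \<ge> 2" and strict: "strict_m_isometry m T"
  shows "UNIV = {h. poly_seq_degree_le (m - 1) (orbit_norm_sq T h)}" (is ?a)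
    and "closed {h. poly_seq_degree_le (m - 2) (orbit_norm_sq T h)}" (is ?b)
    and "interior (closure {h. poly_seq_degree_le (m - 2) (orbit_norm_sq T h)}) = {}" (is ?b')
    and "open {h. poly_seq_degree (m - 1) (orbit_norm_sq T h)}" (is ?c)
    and "closure {h. poly_seq_degree (m - 1) (orbit_norm_sq T h)} = UNIV" (is ?c')
proof -
  obtain d where d: "m = Suc (Suc d)"
    using \<open>m \<ge> 2\<close> by (metis Suc_le_D numeral_2_eq_2 Suc_le_mono)
  have iso: "m_isometry (Suc (Suc d)) T" and not_iso: "\<not> m_isometry (Suc d) T"
    using strict by (auto simp: strict_m_isometry_def d)
  let ?S = "{h. poly_seq_degree_le d (orbit_norm_sq T h)}"
  have all: "poly_seq_degree_le (Suc d) (orbit_norm_sq T h)" for h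
    using iso m_isometry_iff_poly_seq_degree_le[OF T] by blast
  have "bounded_linear (T ^^ n)" for n
    using bounded_clinear_funpow[OF T] by (simp add: bounded_clinear_def)
  then have "continuous_on UNIV (\<lambda>h. alt_sum (Suc d) (orbit_norm_sq T ((T ^^ n) h)))" for n
    using continuous_on_compose2[OF continuous_on_alt_sum_orbit[OF T, of UNIV]] linear_continuous_on
    by blast
  then have cl: "closed ?S"
    unfolding poly_seq_degree_le_orbit_iff
    by (intro closed_Collect_all closed_Collect_eq continuous_on_const)
  have "?S \<subseteq> {h. alt_sum (Suc d) (orbit_norm_sq T h) = 0}"
    unfolding poly_seq_degree_le_orbit_iff by (auto dest: spec[of _ 0])
  then have int: "interior ?S = {}"
    using m_isometry_of_interior[OF T, of "Suc d"] not_iso interior_mono[of ?S] by auto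
  have compl: "{h. poly_seq_degree (Suc d) (orbit_norm_sq T h)} = - ?S"
    using all by (auto simp: poly_seq_degree_Suc_iff)
  show ?a ?b ?b' ?c ?c'
    using all cl int compl by (simp_all add: d closure_complement open_Compl)
qed

text \<open>Mutual equivalence of the five conditions is expressed by comparing each of (ii) to (v)
  with (i); nowhere dense is expressed as a closure with empty interior.\<close>

theorem theorem3p4:
  fixes T :: "'a::chilbert_space \<Rightarrow> 'a"
  assumes "bounded_clinear T"
  shows
    "((\<exists>m\<ge>1. m_isometry m T) \<longleftrightarrow>
        (\<forall>h. poly_seq (orbit_norm_sq T h))) \<and>
     ((\<exists>m\<ge>1. m_isometry m T) \<longleftrightarrow>
        {x. T x = 0} = {0} \<and>
        (\<forall>h. h \<noteq> 0 \<longrightarrow> (\<exists>m\<ge>1. m_isometry m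
           (weighted_shift
              (\<lambda>n. complex_of_real (norm ((T ^^ (n + 1)) h) / norm ((T ^^ n) h))))))) \<and>
     ((\<exists>m\<ge>1. m_isometry m T) \<longleftrightarrow>
        (\<exists>V. open V \<and> V \<noteq> {} \<and>
           (\<forall>h\<in>V. \<exists>m\<ge>1. cinner (defect_on UNIV m T h) h = 0))) \<and>
     ((\<exists>m\<ge>1. m_isometry m T) \<longleftrightarrow>
        (\<forall>h. \<exists>m\<ge>1. m_isometry_on (closure (orbit_span T h)) m T)) \<and>
     (\<forall>m\<ge>2. strict_m_isometry m T \<longrightarrow>
        UNIV = {h. poly_seq_degree_le (m - 1) (orbit_norm_sq T h)} \<and>
        (closed {h. poly_seq_degree_le (m - 2) (orbit_norm_sq T h)} \<and>
         interior (closure {h. poly_seq_degree_le (m - 2) (orbit_norm_sq T h)}) = {}) \<and>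
        (open {h. poly_seq_degree (m - 1) (orbit_norm_sq T h)} \<and>
         closure {h. poly_seq_degree (m - 1) (orbit_norm_sq T h)} = UNIV))"
  by (intro conjI allI impI m_isometry_iff_poly_seq[OF assms]
      m_isometry_iff_weighted_shift[OF assms] m_isometry_iff_local[OF assms]
      m_isometry_iff_orbit_span[OF assms] strict_m_isometry_poly_seq_degree[OF assms])

end
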